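(* Let $w,v\in\Sigma^\ast$ with $\mathrm{alph}(w)=\mathrm{alph}(v)$, and let $I\subseteq E(G(w,v))$ be a set of pairwise independent (i.e. pairwise vertex-disjoint) edges. Then there exist $1$-uniform words $u_w,u_v\in\Sigma^\ast$ with $\mathrm{alph}(u_w)=\mathrm{alph}(u_v)=\mathrm{alph}(w)$ such that $E(G(wu_w,vu_v))=E(G(w,v))\setminus I$.
   Context: $\Sigma$ is a finite alphabet. For a word $w$, $\mathrm{alph}(w)$ is the set of letters occurring in $w$ and $|w|_a$ the number of occurrences of $a$; a word $u$ is $1$-uniform if $|u|_a=1$ for every $a\in\mathrm{alph}(u)$. For letters $a,b$, $\pi_{a,b}$ is the monoid morphism on $\Sigma^\ast$ with $a\mapsto a$, $b\mapsto b$ and all other letters mapped to the empty word. For words $w,v$ with $\mathrm{alph}(w)=\mathrm{alph}(v)=A$, $G(w,v)$ is the undirected simple graph on vertex set $A$ in which distinct $a,b$ are adjacent iff $\pi_{a,b}(w)=\pi_{a,b}(v)$; $E(\cdot)$ denotes the edge set. *)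

theory Defs
  imports Main
begin

definition alph :: "'a list \<Rightarrow> 'a set" where
  "alph w = set w"

definition one_uniform :: "'a list \<Rightarrow> bool" where
  "one_uniform u \<longleftrightarrow> (\<forall>a \<in> alph u. count_list u a = 1)"

definition proj :: "'a \<Rightarrow> 'a \<Rightarrow> 'a list \<Rightarrow> 'a list" where
  "proj a b w = concat (map (\<lambda>c. if c = a \<or> c = b then [c] else []) w)"

type_synonym 'a ugraph = "'a set \<times> 'a set set"

definition E :: "'a ugraph \<Rightarrow> 'a set set" where
  "E H = snd H"

text \<open>Edges are two-element vertex sets. The graph is only meaningful for words with
  \<open>alph w = alph v\<close>, so taking \<open>alph w\<close> as the vertex set is no loss of symmetry.\<close>

definition G :: "'a list \<Rightarrow> 'a list \<Rightarrow> 'a ugraph" where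
  "G w v = (alph w,
     {{a, b} | a b. a \<in> alph w \<and> b \<in> alph w \<and> a \<noteq> b \<and> proj a b w = proj a b v})"

end

theory Submission
  imports Defs
begin

text \<open>
  Appending 1-uniform words adds one occurrence of each letter, so the projections of the two
  suffixes to \<open>{a, b}\<close> have equal length; hence the projections of \<open>w u\<^sub>w\<close> and \<open>v u\<^sub>v\<close> agree iff
  those of \<open>w, v\<close> and those of \<open>u\<^sub>w, u\<^sub>v\<close> agree. It remains to find two 1-uniform words that
  disagree exactly on \<open>I\<close>: with \<open>I = {{a\<^sub>1, b\<^sub>1}, \<dots>, {a\<^sub>k, b\<^sub>k}}\<close> and \<open>r\<close> listing the
  unmatched letters, take \<open>a\<^sub>1b\<^sub>1\<dots>a\<^sub>kb\<^sub>kr\<close> and \<open>b\<^sub>1a\<^sub>1\<dots>b\<^sub>ka\<^sub>kr\<close>.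
\<close>

lemma proj_eq_filter: "proj a b w = filter (\<lambda>c. c = a \<or> c = b) w"
  by (induction w) (auto simp: proj_def)

lemma distinct_imp_one_uniform: "distinct u \<Longrightarrow> one_uniform u"
  unfolding one_uniform_def alph_def
  by (induction u) (auto simp: count_list_0_iff)

text \<open>Induction on the matching, starting from \<open>xs\<close> for both words. Each new edge
  is prepended in opposite orders.\<close>

lemma exists_words_differing_on_matching:
  assumes "finite I" and "pairwise disjnt I"
    and "\<And>e. e \<in> I \<Longrightarrow> \<exists>a b. a \<noteq> b \<and> e = {a, b}"
    and "distinct xs" and "set xs \<inter> \<Union>I = {}"
  shows "\<exists>u u'. distinct u \<and> distinct u' \<and> set u = set xs \<union> \<Union>I \<and> set u' = set xs \<union> \<Union>I \<and>
           (\<forall>a b. proj a b u = proj a b u' \<longleftrightarrow> {a, b} \<notin> I)"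
  using assms
proof (induction I rule: finite_induct)
  case empty
  then show ?case by auto
next
  case (insert e I)
  obtain c d where cd: "c \<noteq> d" "e = {c, d}"
    using insert.prems(2) by blast
  have "\<exists>u u'. distinct u \<and> distinct u' \<and> set u = set xs \<union> \<Union>I \<and> set u' = set xs \<union> \<Union>I \<and>
          (\<forall>a b. proj a b u = proj a b u' \<longleftrightarrow> {a, b} \<notin> I)"
    using insert.prems by (intro insert.IH) (auto simp: pairwise_insert)
  then obtain u u' where u: "distinct u" "distinct u'" "set u = set xs \<union> \<Union>I" "set u' = set xs \<union> \<Union>I"
    "\<And>a b. proj a b u = proj a b u' \<longleftrightarrow> {a, b} \<notin> I"
    by blast
  \<comment> \<open>Disjointness of the edges makes \<open>c\<close> and \<open>d\<close> new to
    \<open>u\<close> and \<open>u'\<close>, so prepending them keeps both words distinct.\<close>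
  have "e \<inter> \<Union>I = {}"
    using insert.prems(1) insert.hyps(2) by (fastforce simp: pairwise_insert disjnt_def)
  then have fresh: "c \<notin> set xs \<union> \<Union>I" "d \<notin> set xs \<union> \<Union>I"
    using cd insert.prems(4) by auto
  have "proj a b (c # d # u) = proj a b (d # c # u') \<longleftrightarrow> {a, b} \<notin> insert e I" for a b
  proof (cases "{a, b} = e")
    case True
    then show ?thesis
      using cd by (auto simp: proj_eq_filter doubleton_eq_iff)
  next
    case False
    \<comment> \<open>A pair other than \<open>e\<close> retains at most one of \<open>c\<close>,
      \<open>d\<close>, so their order is invisible and both projections gain the same
      prefix.\<close>
    then have "\<not> ((c = a \<or> c = b) \<and> (d = a \<or> d = b))"
      using cd by auto
    then have "proj a b (c # d # u) = proj a b (d # c # u') \<longleftrightarrow> proj a b u = proj a b u'"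
      by (auto simp: proj_eq_filter)
    then show ?thesis
      using u(5) False by simp
  qed
  moreover have "distinct (c # d # u)" "distinct (d # c # u')"
    using u fresh cd by auto
  moreover have "set (c # d # u) = set xs \<union> \<Union>(insert e I)" "set (d # c # u') = set xs \<union> \<Union>(insert e I)"
    using u cd by auto
  ultimately show ?case by blast
qed

lemma length_proj_distinct:
  assumes "distinct u" and "distinct u'" and "set u = set u'"
  shows "length (proj a b u) = length (proj a b u')"
  using assms by (simp add: proj_eq_filter distinct_length_filter)

text \<open>The projected suffixes have equal length, so an equality of the concatenations splits at
  the boundary.\<close>

lemma proj_append_eq_iff:
  assumes "distinct u" and "distinct u'" and "set u = set u'"
  shows "proj a b (w @ u) = proj a b (v @ u') \<longleftrightarrow>
           proj a b w = proj a b v \<and> proj a b u = proj a b u'"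
  using length_proj_distinct[OF assms, of a b]
  by (simp add: proj_eq_filter)

theorem theorem4:
  fixes \<Sigma> :: "'a set" and w v :: "'a list" and I :: "'a set set"
  assumes "finite \<Sigma>"
    and "w \<in> lists \<Sigma>" and "v \<in> lists \<Sigma>"
    and "alph w = alph v"
    and "I \<subseteq> E (G w v)"
    and "pairwise disjnt I"
  shows "\<exists>u_w \<in> lists \<Sigma>. \<exists>u_v \<in> lists \<Sigma>.
           one_uniform u_w \<and> one_uniform u_v \<and>
           alph u_w = alph w \<and> alph u_v = alph w \<and>
           E (G (w @ u_w) (v @ u_v)) = E (G w v) - I"
proof -
  have edges: "\<exists>a b. a \<in> set w \<and> b \<in> set w \<and> a \<noteq> b \<and> e = {a, b}" if "e \<in> I" for e
    using that assms(5) unfolding E_def G_def alph_def by fastforce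
  then have sub: "\<Union>I \<subseteq> set w"
    by fastforce
  then have "finite I"
    by (meson finite_UnionD finite_set finite_subset)
  \<comment> \<open>The letters missed by the matching fill the words up to all of
    \<open>set w\<close>.\<close>
  obtain xs where xs: "distinct xs" "set xs = set w - \<Union>I"
    using finite_distinct_list[of "set w - \<Union>I"] by auto
  have "\<exists>u u'. distinct u \<and> distinct u' \<and> set u = set xs \<union> \<Union>I \<and> set u' = set xs \<union> \<Union>I \<and>
          (\<forall>a b. proj a b u = proj a b u' \<longleftrightarrow> {a, b} \<notin> I)"
    using \<open>finite I\<close> assms(6) edges xs
    by (intro exists_words_differing_on_matching) blast+
  then obtain u u' where u: "distinct u" "distinct u'" "set u = set w" "set u' = set w"
    and diff: "\<And>a b. proj a b u = proj a b u' \<longleftrightarrow> {a, b} \<notin> I"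
    using xs sub by (auto simp: Un_absorb2)
  have "proj a b (w @ u) = proj a b (v @ u') \<longleftrightarrow> proj a b w = proj a b v \<and> {a, b} \<notin> I" for a b
    using proj_append_eq_iff[of u u'] u diff by simp
  \<comment> \<open>As \<open>set u = set w\<close>, appending leaves the vertex set
    unchanged.\<close>
  then have "E (G (w @ u) (v @ u')) = E (G w v) - I"
    using u(3) by (auto simp: E_def G_def alph_def)
  moreover have "u \<in> lists \<Sigma>" "u' \<in> lists \<Sigma>"
    using u assms(2) by (auto simp: in_lists_conv_set)
  ultimately show ?thesis
    using u distinct_imp_one_uniform unfolding alph_def by blast
qed

end
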